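(* Let $t,k,v,\lambda$ be positive integers with $k\ge t\ge 2$ and $v\ge 2$. Denote $p=1/v^t$ and $a=\sqrt{\frac{(1-p)^{2\lambda}-p^{2\lambda}}{1-2p}}$. Then \[ \mathsf{CAN}_\lambda(t,k,v)\le 1+\frac{\lambda}{\log(1-p)}\,W_{-1}\!\left(\frac{\log(1-p)}{e\left(\binom{k}{t}v^t a(1-p)\right)^{1/\lambda}}\right). \]
   Context: A covering array $\mathsf{CA}_\lambda(N;t,k,v)$ is an $N\times k$ array with entries from an alphabet $\Sigma$ of size $v$ such that for every set of $t$ distinct columns and every tuple $x\in\Sigma^t$, the tuple $x$ occurs as a row of the $N\times t$ subarray formed by those columns at least $\lambda$ times. $\mathsf{CAN}_\lambda(t,k,v)$ is the smallest $N$ for which a $\mathsf{CA}_\lambda(N;t,k,v)$ exists. $\log$ is the natural logarithm. $W_{-1}$ is the lower real branch of the Lambert $W$ function: for $-1/e\le x<0$, $W_{-1}(x)$ is the unique real $w\le -1$ with $we^w=x$. *)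

theory Defs
  imports Complex_Main "HOL-Library.FuncSet"
begin

text \<open>
  An \<open>N \<times> k\<close> array is a function \<open>A\<close> from row and column indices to entries; only its values
  at rows \<open>r < N\<close> and columns \<open>c < k\<close> matter.  For a set \<open>C\<close> of \<open>t\<close> columns, a \<open>t\<close>-tuple over the
  alphabet is represented as a function \<open>x\<close> on \<open>C\<close>, that is, indexed by the columns themselves.
\<close>

definition covering_array ::
  "nat \<Rightarrow> nat \<Rightarrow> nat \<Rightarrow> nat \<Rightarrow> 'a set \<Rightarrow> (nat \<Rightarrow> nat \<Rightarrow> 'a) \<Rightarrow> bool" where
  "covering_array lam N t k S A \<longleftrightarrow>
     (\<forall>r<N. \<forall>c<k. A r c \<in> S) \<and>
     (\<forall>C. C \<subseteq> {..<k} \<and> card C = t \<longrightarrow>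
        (\<forall>x \<in> C \<rightarrow>\<^sub>E S. lam \<le> card {r. r < N \<and> (\<forall>c\<in>C. A r c = x c)}))"

text \<open>
  Existence of a covering array depends only on the size of the alphabet, so alphabets that are
  finite sets of naturals suffice.
\<close>

definition CAN :: "nat \<Rightarrow> nat \<Rightarrow> nat \<Rightarrow> nat \<Rightarrow> nat" where
  "CAN lam t k v =
     (LEAST N. \<exists>(S::nat set) A. finite S \<and> card S = v \<and> covering_array lam N t k S A)"

text \<open>Meaningful only for \<open>- 1 / e \<le> x < 0\<close>, where such a \<open>w\<close> exists and is unique.\<close>

definition lambert_Wm1 :: "real \<Rightarrow> real" where
  "lambert_Wm1 x = (THE w. w \<le> -1 \<and> w * exp w = x)"

end

theory Submission
  imports Defs
begin

text \<open>
  Fill the array uniformly at random.  The number \<open>X\<close> of rows covering a fixed tuple on a fixed set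
  of \<open>t\<close> columns is binomial with parameters \<open>N\<close> and \<open>p\<close>, so the exponential Markov inequality
  \<open>P(X < \<lambda>) \<le> y\<^sup>1\<^sup>-\<^sup>\<lambda> E(y\<^sup>X) = y\<^sup>1\<^sup>-\<^sup>\<lambda> (1 - p + p y)\<^sup>N\<close> at \<open>y = \<lambda>/N\<close>, together with
  \<open>a \<ge> (1 - p)\<^sup>\<lambda>\<^sup>-\<^sup>1\<close>, gives \<open>P(X < \<lambda>) \<le> a (1 - p)\<^sup>N\<^sup>+\<^sup>1 (e N/\<lambda>)\<^sup>\<lambda>\<close>.  By the union bound an array of
  \<open>N\<close> rows exists as soon as \<open>(k choose t) v\<^sup>t\<close> times this quantity is below \<open>1\<close>.  Taking \<open>\<lambda>\<close>-th
  roots, equality becomes \<open>w e\<^sup>w = ln (1 - p) / (e B)\<close> for \<open>w = N ln (1 - p) / \<lambda>\<close> and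
  \<open>B\<^sup>\<lambda> = (k choose t) v\<^sup>t a (1 - p)\<close>, which is where the Lambert function enters.
\<close>

section \<open>The lower branch of the Lambert function\<close>

text \<open>The derivative \<open>(1 + x) * exp x\<close> is negative below \<open>-1\<close>. This
  gives uniqueness on the branch and, in the theorem, turns \<open>N0 < N\<close> into a strict
  inequality.\<close>

lemma mult_exp_strict_antimono:
  fixes u w :: real
  assumes "u < w" "w \<le> -1"
  shows "w * exp w < u * exp u"
proof -
  have "(\<lambda>x. x * exp x) u > (\<lambda>x. x * exp x) w"
  proof (rule DERIV_neg_imp_decreasing_open[OF assms(1)])
    fix x assume x: "u < x" "x < w"
    have "((\<lambda>x. x * exp x) has_real_derivative (1 + x) * exp x) (at x)"
      by (auto intro!: derivative_eq_intros simp: algebra_simps)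
    moreover have "(1 + x) * exp x < 0"
      using x assms(2) by (intro mult_neg_pos) auto
    ultimately show "\<exists>y. ((\<lambda>x. x * exp x) has_real_derivative y) (at x) \<and> y < 0"
      by blast
  qed (intro continuous_intros)
  then show ?thesis by simp
qed

lemma lambert_Wm1:
  fixes x :: real
  assumes "- exp (-1) \<le> x" "x < 0"
  shows "lambert_Wm1 x \<le> -1" "lambert_Wm1 x * exp (lambert_Wm1 x) = x"
proof -
  have "((\<lambda>z::real. - (z / exp z)) \<longlongrightarrow> - 0) at_top"
    using tendsto_power_div_exp_0[of 1] by (intro tendsto_minus) simp
  then have "\<forall>\<^sub>F z in at_top. x < - (z / exp z)"
    using assms(2) by (intro order_tendstoD(1)) auto
  then obtain Z where Z: "\<And>z. z \<ge> Z \<Longrightarrow> x < - (z / exp z)"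
    by (auto simp: eventually_at_top_linorder)
  \<comment> \<open>Left endpoint for the intermediate value theorem: \<open>u * exp u\<close> tends
    to 0 from below as \<open>u\<close> decreases, so it exceeds the negative \<open>x\<close> far
    enough out.\<close>
  define u where "u = - max Z 1"
  have u: "u \<le> -1" "x \<le> u * exp u"
    using Z[of "- u"] by (auto simp: u_def exp_minus field_simps)
  have "\<exists>w. u \<le> w \<and> w \<le> -1 \<and> w * exp w = x"
    using u assms(1) by (intro IVT2') (auto intro!: continuous_intros)
  then obtain w where w: "w \<le> -1" "w * exp w = x" by blast
  have "\<exists>!w. w \<le> -1 \<and> w * exp w = x"
  proof (rule ex1I)
    fix z assume z: "z \<le> -1 \<and> z * exp z = x"
    show "z = w"
      using mult_exp_strict_antimono[of z w] mult_exp_strict_antimono[of w z] z w by force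
  qed (use w in auto)
  from theI'[OF this] show "lambert_Wm1 x \<le> -1" "lambert_Wm1 x * exp (lambert_Wm1 x) = x"
    by (auto simp: lambert_Wm1_def)
qed

section \<open>Random arrays by counting\<close>

text \<open>Unnormalised generating function of a binomial variable: the weight is a product over
  rows, and rows are chosen independently, so the sum factors.\<close>

lemma sum_PiE_power_card:
  fixes y :: real
  assumes "finite I" "finite R" "G \<subseteq> R"
  shows "(\<Sum>A\<in>I \<rightarrow>\<^sub>E R. y ^ card {r\<in>I. A r \<in> G})
    = (real (card (R - G)) + real (card G) * y) ^ card I"
proof -
  have "y ^ card {r\<in>I. A r \<in> G} = (\<Prod>r\<in>I. if A r \<in> G then y else 1)" for A
    using assms(1) by (simp add: prod.If_cases Int_def)
  then have "(\<Sum>A\<in>I \<rightarrow>\<^sub>E R. y ^ card {r\<in>I. A r \<in> G})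
      = (\<Sum>A\<in>I \<rightarrow>\<^sub>E R. \<Prod>r\<in>I. if A r \<in> G then y else 1)" by simp
  also have "\<dots> = (\<Prod>r\<in>I. \<Sum>z\<in>R. if z \<in> G then y else 1)"
    using assms(1,2) by (intro prod_sum_PiE[symmetric]) auto
  also have "(\<Sum>z\<in>R. if z \<in> G then y else 1) = real (card (R - G)) + real (card G) * y"
    using assms(2,3) by (simp add: sum.If_cases Int_absorb1 Diff_eq)
  finally show ?thesis by simp
qed

text \<open>Exponential Markov inequality: since \<open>y \<le> 1\<close>, each array with fewer
  than \<open>lam\<close> hits has weight at least \<open>y ^ (lam - 1)\<close> in the generating
  function.\<close>

lemma card_few_hits_bound:
  fixes y :: real
  assumes "finite I" "finite R" "G \<subseteq> R" "0 < y" "y \<le> 1" "lam \<ge> 1"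
  shows "real (card {A \<in> I \<rightarrow>\<^sub>E R. card {r\<in>I. A r \<in> G} < lam}) * y ^ (lam - 1)
    \<le> (real (card (R - G)) + real (card G) * y) ^ card I"
proof -
  let ?B = "{A \<in> I \<rightarrow>\<^sub>E R. card {r\<in>I. A r \<in> G} < lam}"
  have fin: "finite (I \<rightarrow>\<^sub>E R)" using assms by (simp add: finite_PiE)
  have "real (card ?B) * y ^ (lam - 1) = (\<Sum>A\<in>?B. y ^ (lam - 1))" by simp
  also have "\<dots> \<le> (\<Sum>A\<in>?B. y ^ card {r\<in>I. A r \<in> G})"
    using assms by (intro sum_mono power_decreasing) auto
  also have "\<dots> \<le> (\<Sum>A\<in>I \<rightarrow>\<^sub>E R. y ^ card {r\<in>I. A r \<in> G})"
    using fin assms(4) by (intro sum_mono2) auto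
  finally show ?thesis using sum_PiE_power_card[OF assms(1-3)] by simp
qed

lemma card_PiE_agree:
  assumes "finite K" "C \<subseteq> K" "x \<in> C \<rightarrow> S"
  shows "card {f \<in> K \<rightarrow>\<^sub>E S. \<forall>c\<in>C. f c = x c} * card S ^ card C = card S ^ card K"
proof -
  have "{f \<in> K \<rightarrow>\<^sub>E S. \<forall>c\<in>C. f c = x c} = PiE K (\<lambda>c. if c \<in> C then {x c} else S)"
    using assms(2,3) by (fastforce simp: PiE_iff split: if_splits)
  then have "card {f \<in> K \<rightarrow>\<^sub>E S. \<forall>c\<in>C. f c = x c} = (\<Prod>c\<in>K. if c \<in> C then 1 else card S)"
    using assms(1) by (simp add: card_PiE if_distrib cong: if_cong)
  also have "\<dots> = card S ^ card (K - C)"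
    using assms(1) by (simp add: prod.If_cases Diff_eq)
  finally show ?thesis
    using assms(1,2) by (simp add: card_Diff_subset finite_subset card_mono flip: power_add)
qed

text \<open>Union bound: under \<open>small\<close>, the bad arrays over all column sets and tuples
  number fewer than all arrays, so some array is never bad.\<close>

lemma CAN_le:
  fixes y p :: real
  assumes "lam \<ge> 1" "v \<ge> 1" "0 < y" "y \<le> 1" "p = 1 / real v ^ t"
    and small: "real (k choose t) * real v ^ t * (1 - p + p * y) ^ N < y ^ (lam - 1)"
  shows "CAN lam t k v \<le> N"
proof -
  \<comment> \<open>Probabilities become cardinalities in \<open>\<Omega>\<close>, whose arrays are
    tuples of whole rows; \<open>B z\<close> is the bad event for the column set and tuple in
    \<open>z\<close>.\<close>
  define S where "S = {..<v}"
  define R where "R = {..<k} \<rightarrow>\<^sub>E S"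
  define \<Omega> where "\<Omega> = {..<N} \<rightarrow>\<^sub>E R"
  define P where "P = (SIGMA C : {C. C \<subseteq> {..<k} \<and> card C = t}. C \<rightarrow>\<^sub>E S)"
  define G where "G = (\<lambda>(C, x). {f \<in> R. \<forall>c\<in>C. f c = x c})"
  define B where "B z = {A \<in> \<Omega>. card {r\<in>{..<N}. A r \<in> G z} < lam}" for z
  have finR: "finite R" and finO: "finite \<Omega>"
    by (auto simp: R_def \<Omega>_def S_def finite_PiE)
  have cardR: "card R = v ^ k" and cardO: "card \<Omega> = card R ^ N"
    by (simp_all add: R_def \<Omega>_def S_def card_PiE)
  have finC: "finite {C. C \<subseteq> {..<k} \<and> card C = t}" by simp
  have finP: "finite P"
    unfolding P_def by (intro finite_SigmaI finC finite_PiE) (auto simp: S_def intro: finite_subset)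
  have cardP: "card P = (k choose t) * v ^ t"
  proof -
    have "card P = (\<Sum>C\<in>{C. C \<subseteq> {..<k} \<and> card C = t}. card (C \<rightarrow>\<^sub>E S))"
      unfolding P_def
      by (intro card_SigmaI finC ballI finite_PiE) (auto simp: S_def intro: finite_subset)
    also have "\<dots> = (\<Sum>C\<in>{C. C \<subseteq> {..<k} \<and> card C = t}. v ^ t)"
      by (intro sum.cong) (auto simp: S_def card_PiE finite_subset[of _ "{..<k}"])
    finally show ?thesis by (simp add: n_subsets)
  qed
  have bound: "real (card (B z)) * y ^ (lam - 1) \<le> real (card \<Omega>) * (1 - p + p * y) ^ N"
    if z: "z \<in> P" for z
  proof -
    have sub: "G z \<subseteq> R" by (auto simp: G_def split: prod.splits)
    have "card (G z) * v ^ t = v ^ k"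
      using z card_PiE_agree[of "{..<k}" "fst z" "snd z" S]
      by (auto simp: G_def R_def P_def S_def PiE_def)
    then have "real (card (G z)) * real v ^ t = real v ^ k"
      by (simp flip: of_nat_power of_nat_mult)
    \<comment> \<open>A uniformly random row covers \<open>z\<close> with probability
      \<open>p\<close>.\<close>
    then have G: "real (card (G z)) = real (card R) * p"
      using assms(2,5) by (simp add: cardR flip: \<open>real (card (G z)) * real v ^ t = real v ^ k\<close>)
    have RG: "real (card (R - G z)) = real (card R) * (1 - p)"
      using sub finR G by (simp add: card_Diff_subset finite_subset card_mono of_nat_diff algebra_simps)
    have "real (card (B z)) * y ^ (lam - 1)
        \<le> (real (card (R - G z)) + real (card (G z)) * y) ^ N"
      using card_few_hits_bound[OF _ finR sub assms(3,4,1), of "{..<N}"]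
      by (simp add: B_def \<Omega>_def)
    also have "real (card (R - G z)) + real (card (G z)) * y = real (card R) * (1 - p + p * y)"
      unfolding G RG by (simp add: algebra_simps)
    finally show ?thesis by (simp add: cardO power_mult_distrib)
  qed
  have "real (card (\<Union>z\<in>P. B z)) * y ^ (lam - 1) \<le> (\<Sum>z\<in>P. real (card (B z))) * y ^ (lam - 1)"
    using card_UN_le[OF finP, of B] assms(3)
    by (intro mult_right_mono) (simp_all flip: of_nat_sum)
  also have "\<dots> \<le> (\<Sum>z\<in>P. real (card \<Omega>) * (1 - p + p * y) ^ N)"
    unfolding sum_distrib_right by (intro sum_mono bound)
  also have "\<dots> = real (card \<Omega>) * (real (k choose t) * real v ^ t * (1 - p + p * y) ^ N)"
    by (simp add: cardP)
  also have "\<dots> < real (card \<Omega>) * y ^ (lam - 1)"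
    using small assms(2) by (intro mult_strict_left_mono) (auto simp: cardO cardR)
  finally have "card (\<Union>z\<in>P. B z) < card \<Omega>" using assms(3) by simp
  then have "\<not> \<Omega> \<subseteq> (\<Union>z\<in>P. B z)"
    using finO finP card_mono[of "\<Union>z\<in>P. B z" \<Omega>] by (auto simp: B_def)
  then obtain A where A: "A \<in> \<Omega>" "\<And>z. z \<in> P \<Longrightarrow> A \<notin> B z" by blast
  have AR: "A r \<in> R" if "r < N" for r using A(1) that by (auto simp: \<Omega>_def)
  have "covering_array lam N t k S A"
    unfolding covering_array_def
  proof (intro conjI allI impI ballI)
    fix r c assume "r < N" "c < k"
    then show "A r c \<in> S" using AR[of r] by (auto simp: R_def)
  next
    fix C x assume Cx: "C \<subseteq> {..<k} \<and> card C = t" "x \<in> C \<rightarrow>\<^sub>E S"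
    then have "(C, x) \<in> P" by (simp add: P_def)
    from A(2)[OF this] have "lam \<le> card {r\<in>{..<N}. A r \<in> G (C, x)}"
      using A(1) by (simp add: B_def)
    also have "{r\<in>{..<N}. A r \<in> G (C, x)} = {r. r < N \<and> (\<forall>c\<in>C. A r c = x c)}"
      using AR by (auto simp: G_def)
    finally show "lam \<le> card {r. r < N \<and> (\<forall>c\<in>C. A r c = x c)}" .
  qed
  moreover have "finite S" "card S = v" by (simp_all add: S_def)
  ultimately show ?thesis unfolding CAN_def by (intro Least_le) blast
qed

section \<open>Estimates for the tail bound\<close>

text \<open>As \<open>(1 - p)\<^sup>2 - p\<^sup>2 = 1 - 2 * p\<close>, the quotient is a geometric
  sum of nonnegative terms whose leading term is the square of the left side.\<close>

lemma power_le_sqrt_quotient: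
  fixes p :: real
  assumes "0 \<le> p" "p < 1 / 2" "n \<ge> 1"
  shows "(1 - p) ^ (n - 1) \<le> sqrt (((1 - p) ^ (2 * n) - p ^ (2 * n)) / (1 - 2 * p))"
proof (rule real_le_rsqrt)
  have "p\<^sup>2 * p ^ (2 * (n - 1)) \<le> p\<^sup>2 * (1 - p) ^ (2 * (n - 1))"
    using assms by (intro mult_left_mono power_mono) auto
  then have "(1 - 2 * p) * (1 - p) ^ (2 * (n - 1)) \<le> (1 - p)\<^sup>2 * (1 - p) ^ (2 * (n - 1)) - p\<^sup>2 * p ^ (2 * (n - 1))"
    by (simp add: power2_eq_square algebra_simps)
  also have "\<dots> = (1 - p) ^ (2 * n) - p ^ (2 * n)"
    using assms(3) by (cases n) (simp_all add: power2_eq_square)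
  finally show "((1 - p) ^ (n - 1))\<^sup>2 \<le> ((1 - p) ^ (2 * n) - p ^ (2 * n)) / (1 - 2 * p)"
    using assms(2) by (simp add: field_simps power_mult[symmetric] mult.commute)
qed

lemma ln_one_minus_ge:
  fixes p :: real
  assumes "p < 1"
  shows "- (p / (1 - p)) \<le> ln (1 - p)"
proof -
  have "- ln (1 - p) \<le> inverse (1 - p) - 1"
    using ln_le_minus_one[of "inverse (1 - p)"] assms by (simp add: ln_inverse)
  also have "\<dots> = p / (1 - p)" using assms by (simp add: field_simps)
  finally show ?thesis by linarith
qed

lemma binomial_tail_estimate:
  fixes p :: real
  assumes "0 \<le> p" "p \<le> 1 / 4" "lam \<ge> 1" "N \<ge> lam"
  shows "(1 - p + p * (real lam / real N)) ^ N
    \<le> (1 - p) ^ (N + lam) * (exp 1 * real N / real lam) ^ lam * (real lam / real N) ^ (lam - 1)"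
proof -
  define y where "y = real lam / real N"
  define r where "r = p / (1 - p)"
  have y: "0 < y" "y \<le> 1" using assms by (auto simp: y_def)
  have r: "0 \<le> r" "2 * r \<le> 1" using assms by (auto simp: r_def field_simps)
  \<comment> \<open>Here \<open>r \<le> 1 - r \<le> 1 + ln (1 - p)\<close>, using
    \<open>2 * r \<le> 1\<close>. This is what yields the extra factor
    \<open>(1 - p) ^ lam\<close>.\<close>
  have "exp r \<le> exp (1 + ln (1 - p))"
    using ln_one_minus_ge[of p] r assms(2) unfolding exp_le_cancel_iff r_def by linarith
  then have er: "exp r \<le> exp 1 * (1 - p)"
    using assms by (simp add: exp_add)
  have "1 - p + p * y = (1 - p) * (1 + r * y)"
    using assms by (simp add: r_def field_simps)
  then have "(1 - p + p * y) ^ N = (1 - p) ^ N * (1 + r * y) ^ N"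
    by (simp add: power_mult_distrib)
  also have "(1 + r * y) ^ N \<le> exp (r * y) ^ N"
    using r y by (intro power_mono exp_ge_add_one_self) auto
  also have "exp (r * y) ^ N = exp r ^ lam"
    using assms by (simp add: y_def flip: exp_of_nat_mult)
  also have "exp r ^ lam \<le> (exp 1 * (1 - p)) ^ lam"
    using er by (intro power_mono) auto
  \<comment> \<open>Giving away \<open>1 / y\<close> creates the factor \<open>y ^ (lam - 1)\<close>
    that cancels against the Markov bound.\<close>
  also have "\<dots> \<le> (exp 1 * (1 - p)) ^ lam / y"
    using y assms by (simp add: field_simps mult_left_le)
  also have "\<dots> = (1 - p) ^ lam * (exp 1 / y) ^ lam * y ^ (lam - 1)"
    using y assms(3) by (cases lam) (simp_all add: power_mult_distrib power_divide)
  finally show ?thesis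
    using assms by (simp add: y_def power_add mult_ac)
qed

theorem theorem4p1:
  fixes t k v lam :: nat and p a :: real
  assumes "lam \<ge> 1" and "t \<ge> 2" and "k \<ge> t" and "v \<ge> 2"
    and "p = 1 / real v ^ t"
    and "a = sqrt (((1 - p) ^ (2 * lam) - p ^ (2 * lam)) / (1 - 2 * p))"
  shows "real (CAN lam t k v) \<le>
    1 + real lam / ln (1 - p) *
      lambert_Wm1 (ln (1 - p) /
        (exp 1 * (real (k choose t) * real v ^ t * a * (1 - p)) powr (1 / real lam)))"
proof -
  define M where "M = real (k choose t) * real v ^ t"
  define B where "B = (M * a * (1 - p)) powr (1 / real lam)"
  define L where "L = ln (1 - p)"
  define w where "w = lambert_Wm1 (L / (exp 1 * B))"
  define N0 where "N0 = real lam / L * w"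
  \<comment> \<open>The least integer strictly above \<open>N0\<close>; the union bound is to be
    strict, while \<open>N0\<close> solves the equality case.\<close>
  define N where "N = nat \<lfloor>1 + N0\<rfloor>"
  have "(2::real) ^ 2 \<le> 2 ^ t" using assms(2) by (intro power_increasing) auto
  also have "\<dots> \<le> real v ^ t" using assms(4) by (intro power_mono) auto
  finally have vt: "4 \<le> real v ^ t" by simp
  then have p: "0 < p" "p \<le> 1 / 4" using assms(4) by (simp_all add: assms(5) divide_le_eq)
  have "1 * 1 \<le> M"
    unfolding M_def using vt assms(3) by (intro mult_mono) (auto simp: Suc_le_eq)
  then have M: "1 \<le> M" by simp
  have a: "(1 - p) ^ (lam - 1) \<le> a"
    unfolding assms(6) using p assms(1) by (intro power_le_sqrt_quotient) auto
  have qa: "(1 - p) ^ lam \<le> a * (1 - p)"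
    using mult_right_mono[OF a, of "1 - p"] p assms(1) by (cases lam) (auto simp: mult_ac)
  also have "\<dots> \<le> M * a * (1 - p)"
    using M p mult_right_mono[of 1 M "a * (1 - p)"] order_trans[OF _ a, of 0] by (simp add: mult_ac)
  finally have Mq: "(1 - p) ^ lam \<le> M * a * (1 - p)" .
  moreover have "0 < (1 - p) ^ lam" using p by simp
  ultimately have Mpos: "0 < M * a * (1 - p)" by linarith
  have Bpos: "0 < B" unfolding B_def powr_gt_zero using Mpos by linarith
  have Bpow: "B ^ lam = M * a * (1 - p)"
  proof -
    have "B ^ lam = B powr real lam" using Bpos by (simp add: powr_realpow)
    also have "\<dots> = (M * a * (1 - p)) powr 1" using assms(1) by (simp add: B_def powr_powr)
    finally show ?thesis using Mpos by (simp only: powr_one[OF less_imp_le])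
  qed
  have Bq: "1 - p \<le> B"
    using Mq[folded Bpow] Bpos assms(1) p by (subst (asm) power_mono_iff) auto
  have "p / (1 - p) \<le> 1 / 2" using p by (simp add: field_simps)
  moreover have "- (p / (1 - p)) \<le> L" using p unfolding L_def by (intro ln_one_minus_ge) simp
  ultimately have L: "L < 0" "- L \<le> 1 / 2" using p by (simp add: L_def, linarith)
  have W: "w \<le> -1" "w * exp w = L / (exp 1 * B)"
  proof -
    \<comment> \<open>Since \<open>- L \<le> 1 / 2 \<le> 1 - p \<le> B\<close>, the argument lies in
      the domain of the branch.\<close>
    have "- 1 \<le> L / B" using L Bq p Bpos by (simp add: field_simps)
    then have x: "- exp (-1) \<le> L / (exp 1 * B)" by (simp add: exp_minus field_simps)
    have "L / (exp 1 * B) < 0" using L Bpos by (simp add: field_simps)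
    with x show "w \<le> -1" "w * exp w = L / (exp 1 * B)"
      by (simp_all add: w_def lambert_Wm1)
  qed
  \<comment> \<open>From \<open>w \<le> -1 \<le> L\<close> one gets \<open>N0 \<ge> lam\<close>, so
    \<open>lam / N\<close> is an admissible \<open>y \<le> 1\<close>.\<close>
  have "real lam * (- L) \<le> real lam * (- w)"
    using W L by (intro mult_left_mono) auto
  then have N0: "real lam \<le> N0" using L by (simp add: N0_def field_simps)
  then have N: "N0 < real N" "real N \<le> 1 + N0"
    unfolding N_def by linarith+
  then have Nlam: "lam \<le> N" using N0 by simp
  have u: "L * real N / real lam < w"
    using N(1) L assms(1) by (simp add: N0_def field_simps)
  have "L / (exp 1 * B) < L * real N / real lam * exp (L * real N / real lam)"
    using mult_exp_strict_antimono[OF u W(1)] W(2) by simp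
  \<comment> \<open>Dividing by the negative \<open>L\<close> reverses the inequality; the
    \<open>lam\<close>-th power then recovers the union bound.\<close>
  then have "exp 1 * real N / real lam * B * exp (L * real N / real lam) < 1"
    using L Bpos assms(1) by (simp add: field_simps)
  then have "(exp 1 * real N / real lam * B * exp (L * real N / real lam)) ^ lam < 1 ^ lam"
    using Bpos assms(1) by (intro power_strict_mono) auto
  moreover have "exp (L * real N / real lam) ^ lam = (1 - p) ^ N"
  proof -
    have "exp (L * real N / real lam) ^ lam = exp (real N * L)"
      using assms(1) by (simp flip: exp_of_nat_mult)
    then show ?thesis using p by (simp only: exp_of_nat_mult) (simp add: L_def)
  qed
  ultimately have lt1: "(exp 1 * real N / real lam) ^ lam * (M * a * (1 - p)) * (1 - p) ^ N < 1"
    by (simp only: power_mult_distrib[of _ B] power_mult_distrib[of _ "exp (L * real N / real lam)"]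
        Bpow power_one)
  have y: "0 < real lam / real N" "real lam / real N \<le> 1" using assms(1) Nlam by auto
  have "M * (1 - p + p * (real lam / real N)) ^ N
      \<le> M * ((1 - p) ^ (N + lam) * (exp 1 * real N / real lam) ^ lam * (real lam / real N) ^ (lam - 1))"
    using M p assms(1) Nlam by (intro mult_left_mono binomial_tail_estimate) auto
  also have "\<dots> = (1 - p) ^ lam *
      (M * (1 - p) ^ N * (exp 1 * real N / real lam) ^ lam * (real lam / real N) ^ (lam - 1))"
    by (simp add: power_add)
  \<comment> \<open>The spare \<open>(1 - p) ^ lam\<close> is weakened to
    \<open>a * (1 - p)\<close>, which is how \<open>a\<close> enters.\<close>
  also have "\<dots> \<le> a * (1 - p) *
      (M * (1 - p) ^ N * (exp 1 * real N / real lam) ^ lam * (real lam / real N) ^ (lam - 1))"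
    using M p by (intro mult_right_mono[OF qa]) auto
  also have "\<dots> = ((exp 1 * real N / real lam) ^ lam * (M * a * (1 - p)) * (1 - p) ^ N)
      * (real lam / real N) ^ (lam - 1)"
    by (simp only: mult_ac)
  also have "\<dots> < 1 * (real lam / real N) ^ (lam - 1)"
    using lt1 y by (intro mult_strict_right_mono zero_less_power) auto
  finally have "CAN lam t k v \<le> N"
    using assms y by (intro CAN_le[of lam v "real lam / real N" p]) (simp_all add: M_def)
  then show ?thesis
    using N(2) by (simp add: N0_def w_def L_def B_def M_def)
qed

end
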